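(* Let $\alpha>-1$ be real with $\alpha\ne0,1,2,\ldots$. Then for all $n=0,1,\ldots$ and $-\infty<\xi<0$, $$\int_0^\infty\frac{\eta^\alpha e^{-\eta}L_n^\alpha(\eta)\,d\eta}{\eta-\xi}=\Gamma(\alpha)\,\Phi(n+1,1-\alpha;-\xi)+\frac{\Gamma(-\alpha)\Gamma(n+\alpha+1)}{n!}(-\xi)^\alpha\,\Phi(n+1+\alpha,1+\alpha;-\xi).$$
   Context: $L_n^\alpha(x)=\sum_{k=0}^n\binom{n+\alpha}{n-k}\frac{(-1)^kx^k}{k!}$ are the (generalized) Laguerre polynomials, with $\binom{a}{n}=\frac{\Gamma(a+1)}{n!\,\Gamma(a-n+1)}$. $\Phi(a,c;x)=\sum_{k=0}^\infty \frac{(a)_k x^k}{(c)_k k!}$ is the confluent hypergeometric function, $(a)_k=a(a+1)\cdots(a+k-1)$. *)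

theory Defs
  imports "HOL-Analysis.Analysis" "HOL-Real_Asymp.Real_Asymp"
begin

definition laguerre :: "nat \<Rightarrow> real \<Rightarrow> real \<Rightarrow> real" where
  "laguerre n \<alpha> x =
     (\<Sum>k=0..n. ((real n + \<alpha>) gchoose (n - k)) * ((-1) ^ k * x ^ k / fact k))"

text \<open>
  The binomial coefficients are usually defined by the Gamma quotient
  \<open>\<Gamma>(a+1) / (m! \<Gamma>(a-m+1))\<close>. For \<open>\<alpha> > -1\<close> no pole occurs in the coefficients of
  \<open>laguerre\<close>, and the two conventions agree:
\<close>

lemma laguerre_coeff_Gamma:
  fixes \<alpha> :: real
  assumes "\<alpha> > -1" and "k \<le> n"
  shows "(real n + \<alpha>) gchoose (n - k) =
    Gamma (real n + \<alpha> + 1) / (fact (n - k) * Gamma (real n + \<alpha> - real (n - k) + 1))"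
proof (rule gbinomial_Gamma)
  show "real n + \<alpha> + 1 \<notin> \<int>\<^sub>\<le>\<^sub>0"
    using assms(1) by (auto elim!: nonpos_Ints_cases')
qed

definition conf_hypergeo :: "real \<Rightarrow> real \<Rightarrow> real \<Rightarrow> real" where
  "conf_hypergeo a c x = (\<Sum>k. pochhammer a k * x ^ k / (pochhammer c k * fact k))"

text \<open>The series converges everywhere unless \<open>c\<close> is a nonpositive integer:\<close>

lemma conf_hypergeo_summable:
  fixes a c x :: real
  assumes "c \<notin> \<int>\<^sub>\<le>\<^sub>0"
  shows "summable (\<lambda>k. pochhammer a k * x ^ k / (pochhammer c k * fact k))"
proof -
  let ?f = "\<lambda>k. pochhammer a k * x ^ k / (pochhammer c k * fact k)"
  let ?r = "\<lambda>k::nat. (a + real k) * x / ((c + real k) * (real k + 1))"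
  have step: "?f (Suc k) = ?r k * ?f k" for k
    by (simp add: pochhammer_Suc field_simps)
  have "?r \<longlonglongrightarrow> 0"
    by real_asymp
  then have "\<forall>\<^sub>F k in sequentially. norm (?r k) < 1 / 2"
    by (intro order_tendstoD(2)[where y = 0] tendsto_norm_zero) auto
  then obtain N where N: "\<And>k. k \<ge> N \<Longrightarrow> norm (?r k) < 1 / 2"
    by (auto simp: eventually_sequentially)
  show ?thesis
  proof (rule summable_ratio_test[where c = "1/2" and N = N])
    fix k assume "N \<le> k"
    then show "norm (?f (Suc k)) \<le> 1 / 2 * norm (?f k)"
      unfolding step norm_mult using N[of k] by (intro mult_right_mono) auto
  qed simp
qed

end

theory Submission
  imports Defs
begin

text \<open>
  Put \<open>x = -\<xi> > 0\<close>. The three-term recurrence of the Laguerre polynomials, together with their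
  orthogonality to constants and \<open>\<eta> / (\<eta> + x) = 1 - x / (\<eta> + x)\<close>, yields a three-term recurrence in \<open>n\<close>
  for the integrals. Both confluent hypergeometric terms satisfy the same recurrence, by the
  contiguous relation in the first parameter. For \<open>n = 0\<close> and \<open>-1 < \<alpha> < 0\<close> the integral equals
  \<open>\<Gamma>(\<alpha>+1) \<integral>\<^sub>0\<^sup>\<infinity> exp (-x s) (1 + s) powr (-\<alpha>-1) ds\<close>, an incomplete Gamma integral: the complete one
  minus a Beta-type integral over \<open>[0,1]\<close> that is expanded termwise. The case of general \<open>\<alpha>\<close> follows
  by increasing \<open>\<alpha>\<close> in unit steps, again through \<open>\<eta> / (\<eta> + x) = 1 - x / (\<eta> + x)\<close>.
\<close>

section \<open>Confluent hypergeometric series: special values and relations between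
  parameters\<close>

lemma conf_hypergeo_sums:
  fixes a c x :: real
  assumes "c \<notin> \<int>\<^sub>\<le>\<^sub>0"
  shows "(\<lambda>k. pochhammer a k * x ^ k / (pochhammer c k * fact k)) sums conf_hypergeo a c x"
  unfolding conf_hypergeo_def by (intro summable_sums conf_hypergeo_summable assms)

lemma conf_hypergeo_nonneg:
  fixes a c x :: real
  assumes "a > 0" "c > 0" "x \<ge> 0"
  shows "conf_hypergeo a c x \<ge> 0"
  unfolding conf_hypergeo_def using assms
  by (intro suminf_nonneg conf_hypergeo_summable divide_nonneg_nonneg mult_nonneg_nonneg pochhammer_nonneg)
    (auto elim!: nonpos_Ints_cases')

lemma conf_hypergeo_self:
  fixes a x :: real
  assumes "a \<notin> \<int>\<^sub>\<le>\<^sub>0"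
  shows "conf_hypergeo a a x = exp x"
proof -
  have "pochhammer a k \<noteq> 0" for k
    using assms by (auto simp: pochhammer_eq_0_iff)
  then have "(\<lambda>k. pochhammer a k * x ^ k / (pochhammer a k * fact k)) = (\<lambda>k. x ^ k /\<^sub>R fact k)"
    by (auto simp: fun_eq_iff field_simps)
  then show ?thesis
    using exp_converges[of x] by (simp add: conf_hypergeo_def sums_iff)
qed

lemma conf_hypergeo_0_left: "conf_hypergeo 0 c x = 1"
proof -
  have "(\<lambda>k. pochhammer 0 k * x ^ k / (pochhammer c k * fact k)) sums (\<Sum>k\<in>{0}. pochhammer 0 k * x ^ k / (pochhammer c k * fact k))"
    by (rule sums_finite) (auto simp: pochhammer_0_left)
  then show ?thesis
    by (simp add: conf_hypergeo_def sums_iff)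
qed

text \<open>The terms are \<open>x ^ k / pochhammer c k\<close>, and splitting off k = 0 leaves a
  multiple of the series for c + 1 because
  \<open>pochhammer c (Suc k) = c * pochhammer (c + 1) k\<close>. This serves the passage from
  \<alpha> to \<alpha> + 1.\<close>

lemma conf_hypergeo_1_left:
  fixes c x :: real
  assumes "c \<notin> \<int>\<^sub>\<le>\<^sub>0"
  shows "conf_hypergeo 1 c x = 1 + x / c * conf_hypergeo 1 (c + 1) x"
proof -
  have c: "c \<noteq> 0" "c + 1 \<notin> \<int>\<^sub>\<le>\<^sub>0" 
    using assms plus_one_in_nonpos_Ints_imp by auto
  define f where "f c k = pochhammer 1 k * x ^ k / (pochhammer c k * fact k)" for c :: real and k
  have "f (c + 1) sums conf_hypergeo 1 (c + 1) x"
    unfolding f_def by (rule conf_hypergeo_sums[OF c(2)])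
  then have "(\<lambda>k. x / c * f (c + 1) k) sums (x / c * conf_hypergeo 1 (c + 1) x)"
    by (rule sums_mult)
  also have "(\<lambda>k. x / c * f (c + 1) k) = (\<lambda>k. f c (Suc k))"
    by (simp add: f_def fun_eq_iff pochhammer_rec[of c] pochhammer_fact[symmetric])
  finally have "f c sums (x / c * conf_hypergeo 1 (c + 1) x + f c 0)"
    by (subst (asm) sums_Suc_iff)
  moreover have "f c sums conf_hypergeo 1 c x"
    unfolding f_def by (rule conf_hypergeo_sums[OF assms])
  ultimately show ?thesis
    by (auto simp: sums_iff f_def)
qed

text \<open>Comparison of coefficients: the combination of the three series without the factor x has
  constant term 0, and its term at k + 1 is x times the term of \<open>conf_hypergeo a c x\<close>
  at k.\<close>

lemma conf_hypergeo_contiguous: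
  fixes a c x :: real
  assumes "c \<notin> \<int>\<^sub>\<le>\<^sub>0"
  shows "a * conf_hypergeo (a + 1) c x =
    (2 * a - c + x) * conf_hypergeo a c x + (c - a) * conf_hypergeo (a - 1) c x"
proof -
  define f where "f a k = pochhammer a k * x ^ k / (pochhammer c k * fact k)" for a :: real and k
  have c: "pochhammer c k \<noteq> 0" for k
    using assms by (auto simp: pochhammer_eq_0_iff)
  have f: "f a sums conf_hypergeo a c x" for a
    unfolding f_def by (rule conf_hypergeo_sums[OF assms])
  define g where "g k = a * f (a + 1) k - (2 * a - c) * f a k - (c - a) * f (a - 1) k" for k
  have "g sums (a * conf_hypergeo (a + 1) c x - (2 * a - c) * conf_hypergeo a c x
      - (c - a) * conf_hypergeo (a - 1) c x)"
    unfolding g_def by (intro sums_diff sums_mult f)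
  moreover have "g (Suc k) = x * f a k" for k
  proof -
    define P where "P = pochhammer a k"
    \<comment> \<open>Each Pochhammer symbol becomes a multiple of P. The third keeps its factor a,
      which completes it to \<open>pochhammer a (k + 2)\<close> without dividing by a.\<close>
    have p: "pochhammer a (Suc k) = (a + k) * P" "pochhammer (a - 1) (Suc k) = (a - 1) * P"
      "a * pochhammer (a + 1) (Suc k) = (a + k) * (a + k + 1) * P"
      using pochhammer_rec[of a "Suc k"]
      by (simp_all add: P_def pochhammer_Suc[of a] pochhammer_rec[of "a - 1"] mult_ac add_ac)
    have ck: "pochhammer c (Suc k) = (c + k) * pochhammer c k" "c + k \<noteq> 0"
      using c[of "Suc k"] by (auto simp: pochhammer_Suc)
    define D where "D = x ^ Suc k / (pochhammer c (Suc k) * fact (Suc k))"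
    have "g (Suc k) = (a * pochhammer (a + 1) (Suc k) - (2 * a - c) * pochhammer a (Suc k)
        - (c - a) * pochhammer (a - 1) (Suc k)) * D"
      by (simp add: g_def f_def D_def algebra_simps diff_divide_distrib add_divide_distrib)
    \<comment> \<open>The polynomial (a+k)(a+k+1) - (2a-c)(a+k) - (c-a)(a-1) factors as (k+1)(c+k),
      which cancels the last factors in the denominator of D.\<close>
    also have "\<dots> = (k + 1) * (c + k) * P * D"
      unfolding p by (simp add: algebra_simps)
    also have "\<dots> = x * f a k"
      using ck c[of k] by (simp add: D_def f_def P_def divide_simps) 
    finally show ?thesis .
  qed
  moreover have "g 0 = 0"
    by (simp add: g_def f_def)
  moreover have "(\<lambda>k. x * f a k) sums (x * conf_hypergeo a c x)"
    by (intro sums_mult f)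
  ultimately have "x * conf_hypergeo a c x = a * conf_hypergeo (a + 1) c x 
      - (2 * a - c) * conf_hypergeo a c x - (c - a) * conf_hypergeo (a - 1) c x"
    using sums_Suc_iff[of g] by (simp add: sums_iff)
  then show ?thesis
    by (simp add: algebra_simps)
qed

section \<open>The integral of the bare weight for -1 < \<alpha> < 0, as a nonnegative
  integral\<close>

lemma nn_integral_Gamma_scaled:
  fixes s c :: real
  assumes "s > 0" "c > 0"
  shows "(\<integral>\<^sup>+t. ennreal (indicator {0<..} t * t powr (s - 1) * exp (-(c * t))) \<partial>lborel)
    = ennreal (Gamma s * c powr (-s))" (is "?I = _")
proof -
  have "ennreal (Gamma s) =
      (\<integral>\<^sup>+t. ennreal (indicator {0<..} t * t powr (s - 1) * exp (-t)) \<partial>lborel)"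
    unfolding Gamma_conv_nn_integral_real[OF assms(1)]
    by (intro nn_integral_cong arg_cong[where f = ennreal])
      (auto simp: indicator_def exp_minus field_simps)
  also have "\<dots> = c * (\<integral>\<^sup>+t. ennreal (indicator {0<..} (c * t) * (c * t) powr (s - 1) * exp (-(c * t))) \<partial>lborel)"
    using assms by (subst nn_integral_real_affine[where c = c and t = 0]) auto
  also have "\<dots> = c * (\<integral>\<^sup>+t. ennreal (c powr (s - 1)) * ennreal (indicator {0<..} t * t powr (s - 1) * exp (-(c * t))) \<partial>lborel)"
    using assms by (intro arg_cong2[where f = "(*)"] refl nn_integral_cong)
      (auto simp: indicator_def zero_less_mult_iff powr_mult ennreal_mult'[symmetric])
  also have "\<dots> = ennreal (c powr s) * (\<integral>\<^sup>+t. ennreal (indicator {0<..} t * t powr (s - 1) * exp (-(c * t))) \<partial>lborel)"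
    using assms by (subst nn_integral_cmult)
      (auto simp: mult.assoc[symmetric] ennreal_mult'[symmetric] powr_mult_base)
  finally have *: "ennreal (Gamma s) = ennreal (c powr s) * ?I" .
  have "ennreal (Gamma s * c powr (-s)) = ennreal (c powr (-s)) * ennreal (Gamma s)"
    using assms by (simp add: ennreal_mult' mult.commute)
  also have "\<dots> = ennreal (c powr (-s) * c powr s) * ?I"
    unfolding * by (simp add: ennreal_mult' mult.assoc)
  also have "\<dots> = ?I"
    using assms by (simp add: powr_add[symmetric])
  finally show ?thesis ..
qed

text \<open>Writing \<open>1 / (\<eta> + x)\<close> as \<open>\<integral> exp (- (\<eta> + x) s) ds\<close> and applying Tonelli.\<close>
lemma nn_integral_Stieltjes_swap:
  fixes \<alpha> x :: real
  assumes "\<alpha> > -1" "x > 0"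
  shows "(\<integral>\<^sup>+\<eta>. ennreal (indicator {0<..} \<eta> * (\<eta> powr \<alpha> * exp (-\<eta>) / (\<eta> + x))) \<partial>lborel)
    = ennreal (Gamma (\<alpha> + 1)) *
      (\<integral>\<^sup>+s. ennreal (indicator {0<..} s * (exp (-(x * s)) * (1 + s) powr (- \<alpha> - 1))) \<partial>lborel)"
proof -
  let ?i = "\<lambda>t::real. indicator {0<..} t :: real"
  let ?F = "\<lambda>\<eta> s. ennreal (?i \<eta> * ?i s * (\<eta> powr \<alpha> * exp (-\<eta>) * exp (-((\<eta> + x) * s))))"
  have "(\<integral>\<^sup>+\<eta>. ennreal (?i \<eta> * (\<eta> powr \<alpha> * exp (-\<eta>) / (\<eta> + x))) \<partial>lborel)
      = (\<integral>\<^sup>+\<eta>. \<integral>\<^sup>+s. ?F \<eta> s \<partial>lborel \<partial>lborel)"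
  proof (intro nn_integral_cong)
    fix \<eta> :: real
    show "ennreal (?i \<eta> * (\<eta> powr \<alpha> * exp (-\<eta>) / (\<eta> + x))) = (\<integral>\<^sup>+s. ?F \<eta> s \<partial>lborel)"
    proof (cases "\<eta> > 0")
      case True
      have "(\<integral>\<^sup>+s. ?F \<eta> s \<partial>lborel) = (\<integral>\<^sup>+s. ennreal (\<eta> powr \<alpha> * exp (-\<eta>)) *
          ennreal (?i s * s powr (1 - 1) * exp (-((\<eta> + x) * s))) \<partial>lborel)"
        using True by (intro nn_integral_cong) (auto simp: indicator_def ennreal_mult'[symmetric])
      also have "\<dots> = ennreal (\<eta> powr \<alpha> * exp (-\<eta>)) * ennreal (Gamma 1 * (\<eta> + x) powr (-1))"
        using True assms by (subst nn_integral_cmult, simp, subst nn_integral_Gamma_scaled) auto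
      also have "\<dots> = ennreal (\<eta> powr \<alpha> * exp (-\<eta>) / (\<eta> + x))"
        using True assms by (simp add: ennreal_mult'[symmetric] powr_minus divide_inverse)
      finally show ?thesis using True by simp
    qed simp
  qed
  also have "\<dots> = (\<integral>\<^sup>+s. \<integral>\<^sup>+\<eta>. ?F \<eta> s \<partial>lborel \<partial>lborel)"
    by (rule lborel_pair.Fubini'[symmetric]) (simp add: case_prod_unfold)
  also have "\<dots> = (\<integral>\<^sup>+s. ennreal (Gamma (\<alpha> + 1)) *
      ennreal (?i s * (exp (-(x * s)) * (1 + s) powr (- \<alpha> - 1))) \<partial>lborel)"
  proof (intro nn_integral_cong)
    fix s :: real
    show "(\<integral>\<^sup>+\<eta>. ?F \<eta> s \<partial>lborel) = ennreal (Gamma (\<alpha> + 1)) *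
      ennreal (?i s * (exp (-(x * s)) * (1 + s) powr (- \<alpha> - 1)))"
    proof (cases "s > 0")
      case True
      have "(\<integral>\<^sup>+\<eta>. ?F \<eta> s \<partial>lborel) = (\<integral>\<^sup>+\<eta>. ennreal (exp (-(x * s))) *
          ennreal (?i \<eta> * \<eta> powr ((\<alpha> + 1) - 1) * exp (-((1 + s) * \<eta>))) \<partial>lborel)"
        using True by (intro nn_integral_cong)
          (auto simp: indicator_def ennreal_mult'[symmetric] exp_add[symmetric] algebra_simps)
      also have "\<dots> = ennreal (exp (-(x * s))) * ennreal (Gamma (\<alpha> + 1) * (1 + s) powr (-(\<alpha> + 1)))"
        using True assms by (subst nn_integral_cmult, simp, subst nn_integral_Gamma_scaled) auto
      also have "\<dots> = ennreal (Gamma (\<alpha> + 1)) * ennreal (?i s * (exp (-(x * s)) * (1 + s) powr (- \<alpha> - 1)))"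
        using True assms by (simp add: ennreal_mult''[symmetric] mult_ac)
      finally show ?thesis .
    qed simp
  qed
  also have "\<dots> = ennreal (Gamma (\<alpha> + 1)) *
      (\<integral>\<^sup>+s. ennreal (?i s * (exp (-(x * s)) * (1 + s) powr (- \<alpha> - 1))) \<partial>lborel)"
    by (rule nn_integral_cmult) simp
  finally show ?thesis .
qed

text \<open>Expanding \<open>exp (x * (1 - s))\<close> in powers of 1 - s gives nonnegative terms,
  so sum and integral interchange. The k-th term is a Beta integral, and
  \<open>Beta a (k + 1)\<close> equals \<open>fact k / (a * pochhammer (1 + a) k)\<close>.\<close>

lemma nn_integral_exp_powr_unit:
  fixes a x :: real
  assumes "a > 0" "x > 0"
  shows "(\<integral>\<^sup>+s. ennreal (indicator {0..1} s * (s powr (a - 1) * exp (x * (1 - s)))) \<partial>lborel)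
    = ennreal (conf_hypergeo 1 (1 + a) x / a)"
proof -
  have Beta: "Beta a (real k + 1) / fact k = 1 / (a * pochhammer (1 + a) k)" for k
  proof -
    have "Gamma (1 + a + k) = pochhammer (1 + a) k * Gamma (1 + a)"
      using assms by (subst pochhammer_Gamma) (auto elim!: nonpos_Ints_cases' simp: Gamma_eq_zero_iff)
    moreover have "Gamma (1 + a) = a * Gamma a"
      using assms by (subst add.commute, intro Gamma_plus1) (auto elim!: nonpos_Ints_cases')
    moreover have "Gamma (real k + 1) = fact k"
      by (simp add: Gamma_fact add.commute)
    moreover have "Gamma a \<noteq> 0"
      using assms Gamma_real_pos[of a] by linarith
    ultimately show ?thesis
      using assms by (simp add: Beta_def ac_simps)
  qed
  have "(\<integral>\<^sup>+s. ennreal (indicator {0..1} s * (s powr (a - 1) * exp (x * (1 - s)))) \<partial>lborel)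
      = (\<integral>\<^sup>+s. (\<Sum>k. ennreal (x ^ k / fact k) * ennreal (indicator {0..1} s * (s powr (a - 1) * (1 - s) ^ k))) \<partial>lborel)"
  proof (intro nn_integral_cong)
    fix s :: real
    have "(\<lambda>k. s powr (a - 1) * ((x * (1 - s)) ^ k /\<^sub>R fact k)) sums (s powr (a - 1) * exp (x * (1 - s)))"
      by (intro sums_mult exp_converges)
    then have *: "(\<Sum>k. ennreal (x ^ k / fact k * (s powr (a - 1) * (1 - s) ^ k))) = ennreal (s powr (a - 1) * exp (x * (1 - s)))"
      if "s \<in> {0..1}"
      using that assms by (intro suminf_ennreal_eq) (auto simp: power_mult_distrib divide_inverse mult_ac)
    show "ennreal (indicator {0..1} s * (s powr (a - 1) * exp (x * (1 - s)))) =
       (\<Sum>k. ennreal (x ^ k / fact k) * ennreal (indicator {0..1} s * (s powr (a - 1) * (1 - s) ^ k)))"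
    proof (cases "s \<in> {0..1}")
      case True
      have "ennreal (x ^ k / fact k) * ennreal t = ennreal (x ^ k / fact k * t)" for k t
        using assms by (intro ennreal_mult'[symmetric]) simp
      with True * show ?thesis by simp
    qed simp
  qed
  also have "\<dots> = (\<Sum>k. ennreal (x ^ k / fact k) * (\<integral>\<^sup>+s. ennreal (indicator {0..1} s * (s powr (a - 1) * (1 - s) ^ k)) \<partial>lborel))"
    by (subst nn_integral_suminf) (auto simp: nn_integral_cmult)
  also have "\<dots> = (\<Sum>k. ennreal (x ^ k / fact k) * ennreal (Beta a (real k + 1)))"
  proof (intro suminf_cong arg_cong2[where f = "(*)"] refl)
    fix k :: nat
    have "((\<lambda>s. s powr (a - 1) * (1 - s) powr ((real k + 1) - 1)) has_integral Beta a (real k + 1)) {0..1}"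
      using assms by (intro has_integral_Beta_real) auto
    \<comment> \<open>The integrands differ at most at s = 1, for k = 0: there
      \<open>0 powr 0 = 0\<close> but \<open>0 ^ 0 = 1\<close>.\<close>
    then have "((\<lambda>s. s powr (a - 1) * (1 - s) ^ k) has_integral Beta a (real k + 1)) {0..1}"
      by (rule has_integral_spike[where S = "{1}", rotated 2]) (auto simp: powr_realpow)
    then show "(\<integral>\<^sup>+s. ennreal (indicator {0..1} s * (s powr (a - 1) * (1 - s) ^ k)) \<partial>lborel) = ennreal (Beta a (real k + 1))"
      by (intro nn_integral_has_integral_lebesgue) auto
  qed
  also have "\<dots> = (\<Sum>k. ennreal (1 / a * (pochhammer 1 k * x ^ k / (pochhammer (1 + a) k * fact k))))"
  proof (intro suminf_cong)
    fix k
    have "ennreal (x ^ k / fact k) * ennreal (Beta a (real k + 1)) = ennreal (x ^ k * (Beta a (real k + 1) / fact k))"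
      using assms by (simp add: ennreal_mult'[symmetric])
    then show "ennreal (x ^ k / fact k) * ennreal (Beta a (real k + 1)) =
        ennreal (1 / a * (pochhammer 1 k * x ^ k / (pochhammer (1 + a) k * fact k)))"
      unfolding Beta by (simp add: pochhammer_fact[symmetric])
  qed
  also have "\<dots> = ennreal (1 / a * conf_hypergeo 1 (1 + a) x)"
    using assms
    by (intro suminf_ennreal_eq sums_mult conf_hypergeo_sums)
      (auto elim!: nonpos_Ints_cases' intro!: mult_nonneg_nonneg divide_nonneg_nonneg pochhammer_nonneg)
  finally show ?thesis by simp
qed

text \<open>After the swap, the remaining integral is, up to the factor \<open>exp x\<close>, the
  tail over (1, \<infinity>) of the complete Gamma integral, translated to start at 0. The second
  claim accompanies the first because \<open>ennreal\<close> sends negative reals to 0, so the first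
  alone would not fix the real value.\<close>

lemma nn_integral_Stieltjes_neg:
  fixes \<alpha> x :: real
  assumes "\<alpha> > -1" "\<alpha> < 0" "x > 0"
  shows "(\<integral>\<^sup>+\<eta>. ennreal (indicator {0<..} \<eta> * (\<eta> powr \<alpha> * exp (-\<eta>) / (\<eta> + x))) \<partial>lborel)
    = ennreal (Gamma \<alpha> * conf_hypergeo 1 (1 - \<alpha>) x + Gamma (-\<alpha>) * Gamma (\<alpha> + 1) * x powr \<alpha> * exp x)" (is ?eq)
    and "Gamma \<alpha> * conf_hypergeo 1 (1 - \<alpha>) x + Gamma (-\<alpha>) * Gamma (\<alpha> + 1) * x powr \<alpha> * exp x \<ge> 0" (is ?nonneg)
proof -
  let ?J = "\<integral>\<^sup>+s. ennreal (indicator {0<..} s * (exp (-(x * s)) * (1 + s) powr (- \<alpha> - 1))) \<partial>lborel"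
  let ?C = "conf_hypergeo 1 (1 - \<alpha>) x / (-\<alpha>)"
  have "ennreal (Gamma (-\<alpha>) * x powr \<alpha>)
      = (\<integral>\<^sup>+s. ennreal (indicator {0<..} s * s powr (- \<alpha> - 1) * exp (-(x * s))) \<partial>lborel)"
    using nn_integral_Gamma_scaled[of "-\<alpha>" x] assms by simp
  \<comment> \<open>Split at s = 1, with \<open>exp (-x)\<close> taken out of the part over [0,1].
    The added endpoint 0 contributes nothing, since \<open>0 powr y = 0\<close>.\<close>
  also have "\<dots> = (\<integral>\<^sup>+s. ennreal (exp (-x)) * ennreal (indicator {0..1} s * (s powr (- \<alpha> - 1) * exp (x * (1 - s))))
      + ennreal (indicator {1<..} s * (exp (-(x * s)) * s powr (- \<alpha> - 1))) \<partial>lborel)"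
    by (intro nn_integral_cong)
      (auto simp: indicator_def ennreal_mult'[symmetric] exp_add[symmetric] algebra_simps)
  also have "\<dots> = ennreal (exp (-x)) * ennreal ?C
      + (\<integral>\<^sup>+s. ennreal (indicator {1<..} s * (exp (-(x * s)) * s powr (- \<alpha> - 1))) \<partial>lborel)"
    using nn_integral_exp_powr_unit[of "-\<alpha>" x] assms
    by (subst nn_integral_add, simp, simp, subst nn_integral_cmult) auto
  also have "(\<integral>\<^sup>+s. ennreal (indicator {1<..} s * (exp (-(x * s)) * s powr (- \<alpha> - 1))) \<partial>lborel)
      = (\<integral>\<^sup>+s. ennreal (indicator {1<..} (1 + 1 * s) * (exp (-(x * (1 + 1 * s))) * (1 + 1 * s) powr (- \<alpha> - 1))) \<partial>lborel)"
    by (subst nn_integral_real_affine[where c = 1 and t = 1]) auto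
  also have "\<dots> = (\<integral>\<^sup>+s. ennreal (exp (-x)) * ennreal (indicator {0<..} s * (exp (-(x * s)) * (1 + s) powr (- \<alpha> - 1))) \<partial>lborel)"
    by (intro nn_integral_cong)
      (auto simp: indicator_def ennreal_mult'[symmetric] exp_add[symmetric] algebra_simps)
  also have "\<dots> = ennreal (exp (-x)) * ?J"
    by (rule nn_integral_cmult) simp
  finally have eq: "ennreal (Gamma (-\<alpha>) * x powr \<alpha>) = ennreal (exp (-x)) * ennreal ?C + ennreal (exp (-x)) * ?J" .
  \<comment> \<open>The tail is a summand of a finite quantity; once it is a real number, the
    equation can be solved for it.\<close>
  have "?J \<noteq> top"
  proof -
    have "ennreal (exp (-x)) * ?J \<noteq> top"
      using eq by (metis ennreal_add_eq_top ennreal_neq_top)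
    then show ?thesis by (auto simp: ennreal_mult_eq_top_iff)
  qed
  then obtain J where J: "?J = ennreal J" "J \<ge> 0"
    by (cases ?J rule: ennreal_cases) blast+
  have "?C \<ge> 0"
    using assms by (intro divide_nonneg_pos conf_hypergeo_nonneg) auto
  then have "ennreal (Gamma (-\<alpha>) * x powr \<alpha>) = ennreal (exp (-x) * (?C + J))"
    unfolding eq J(1) using J(2) by (simp only: ennreal_mult' ennreal_plus exp_ge_zero) (simp only: distrib_left)
  then have "Gamma (-\<alpha>) * x powr \<alpha> = exp (-x) * (?C + J)"
    using \<open>?C \<ge> 0\<close> J(2) assms by (subst (asm) ennreal_inj) (auto intro!: mult_nonneg_nonneg Gamma_real_nonneg)
  then have "J = Gamma (-\<alpha>) * x powr \<alpha> * exp x - ?C"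
    by (simp add: exp_minus field_simps)
  \<comment> \<open>Turns \<open>- Gamma (\<alpha> + 1) * ?C\<close> into
    \<open>Gamma \<alpha>\<close> times the hypergeometric value.\<close>
  moreover have "Gamma (\<alpha> + 1) = \<alpha> * Gamma \<alpha>"
    using assms by (intro Gamma_plus1) (auto elim!: nonpos_Ints_cases')
  ultimately have V: "Gamma (\<alpha> + 1) * J = Gamma \<alpha> * conf_hypergeo 1 (1 - \<alpha>) x + Gamma (-\<alpha>) * Gamma (\<alpha> + 1) * x powr \<alpha> * exp x"
    using assms by (simp add: algebra_simps)
  show ?eq
    using nn_integral_Stieltjes_swap[of \<alpha> x] assms J by (simp only: ennreal_mult''[symmetric] V)
  have "Gamma (\<alpha> + 1) \<ge> 0"
    using assms by (intro Gamma_real_nonneg) auto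
  then show ?nonneg
    using J(2) by (simp only: V[symmetric] mult_nonneg_nonneg)
qed

section \<open>Real-valued integrals and the case n = 0 for every nonintegral \<alpha> > -1\<close>

lemma set_integral_Gamma:
  fixes \<beta> :: real
  assumes "\<beta> > -1"
  shows "set_integrable lborel {0<..} (\<lambda>\<eta>. \<eta> powr \<beta> * exp (-\<eta>))"
    and "(LBINT \<eta>:{0<..}. \<eta> powr \<beta> * exp (-\<eta>)) = Gamma (\<beta> + 1)"
proof -
  have "has_bochner_integral lborel (\<lambda>\<eta>. indicator {0<..} \<eta> *\<^sub>R (\<eta> powr \<beta> * exp (-\<eta>))) (Gamma (\<beta> + 1))"
    using nn_integral_Gamma_scaled[of "\<beta> + 1" 1] assms
    by (intro has_bochner_integral_nn_integral) (auto simp: mult.assoc intro!: Gamma_real_nonneg)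
  then show "set_integrable lborel {0<..} (\<lambda>\<eta>. \<eta> powr \<beta> * exp (-\<eta>))"
    and "(LBINT \<eta>:{0<..}. \<eta> powr \<beta> * exp (-\<eta>)) = Gamma (\<beta> + 1)"
    by (auto simp: set_integrable_def set_lebesgue_integral_def has_bochner_integral_iff)
qed

text \<open>On the half-line \<eta> + x exceeds x, so f / x dominates.\<close>

lemma set_integrable_div_shift:
  fixes f :: "real \<Rightarrow> real"
  assumes f: "set_integrable lborel {0<..} f" and "x > 0"
  shows "set_integrable lborel {0<..} (\<lambda>\<eta>. f \<eta> / (\<eta> + x))"
proof (rule set_integrable_bound)
  show "set_integrable lborel {0<..} (\<lambda>\<eta>. f \<eta> / x)"
    using f by simp
  have [measurable]: "(\<lambda>\<eta>. indicator {0<..} \<eta> *\<^sub>R f \<eta>) \<in> borel_measurable lborel"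
    using f unfolding set_integrable_def by (rule borel_measurable_integrable)
  have "(\<lambda>\<eta>. (indicator {0<..} \<eta> *\<^sub>R f \<eta>) / (\<eta> + x)) \<in> borel_measurable lborel"
    by measurable
  then show "set_borel_measurable lborel {0<..} (\<lambda>\<eta>. f \<eta> / (\<eta> + x))"
    by (simp add: set_borel_measurable_def)
  show "AE \<eta> in lborel. \<eta> \<in> {0<..} \<longrightarrow> norm (f \<eta> / (\<eta> + x)) \<le> norm (f \<eta> / x)"
    using assms by (auto simp: abs_mult divide_simps intro!: AE_I2 mult_left_mono)
qed

text \<open>Write \<alpha> = \<beta> + m with -1 < \<beta> < 0 and induct on m; the base case is the
  nonnegative integral above.\<close>

lemma set_integral_Stieltjes:
  fixes \<alpha> x :: real
  assumes "\<alpha> > -1" "\<alpha> \<notin> \<nat>" "x > 0"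
  shows "(LBINT \<eta>:{0<..}. \<eta> powr \<alpha> * exp (-\<eta>) / (\<eta> + x)) =
    Gamma \<alpha> * conf_hypergeo 1 (1 - \<alpha>) x + Gamma (-\<alpha>) * Gamma (\<alpha> + 1) * x powr \<alpha> * exp x"
proof -
  have shifted: "(LBINT \<eta>:{0<..}. \<eta> powr (\<beta> + real m) * exp (-\<eta>) / (\<eta> + x)) =
      Gamma (\<beta> + real m) * conf_hypergeo 1 (1 - (\<beta> + real m)) x
      + Gamma (-(\<beta> + real m)) * Gamma (\<beta> + real m + 1) * x powr (\<beta> + real m) * exp x"
    if \<beta>: "\<beta> > -1" "\<beta> < 0" for \<beta> :: real and m
  proof (induction m)
    case 0
    let ?V = "Gamma \<beta> * conf_hypergeo 1 (1 - \<beta>) x + Gamma (-\<beta>) * Gamma (\<beta> + 1) * x powr \<beta> * exp x"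
    have int: "set_integrable lborel {0<..} (\<lambda>\<eta>. \<eta> powr \<beta> * exp (-\<eta>) / (\<eta> + x))"
      by (intro set_integrable_div_shift set_integral_Gamma \<beta> assms)
    have "ennreal (LBINT \<eta>:{0<..}. \<eta> powr \<beta> * exp (-\<eta>) / (\<eta> + x)) = ennreal ?V"
      unfolding nn_integral_Stieltjes_neg(1)[OF \<beta> assms(3), symmetric] set_lebesgue_integral_def
      using int assms(3) unfolding set_integrable_def
      by (subst nn_integral_eq_integral[symmetric]) (auto simp: indicator_def)
    moreover have "(LBINT \<eta>:{0<..}. \<eta> powr \<beta> * exp (-\<eta>) / (\<eta> + x)) \<ge> 0"
      unfolding set_lebesgue_integral_def using assms(3)
      by (intro integral_nonneg_AE AE_I2) (auto simp: indicator_def)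
    ultimately show ?case
      using nn_integral_Stieltjes_neg(2)[OF \<beta> assms(3)] by simp
  next
    case (Suc m)
    define \<gamma> where "\<gamma> = \<beta> + real m"
    have \<gamma>: "\<gamma> > -1" using \<beta> by (simp add: \<gamma>_def)
    \<comment> \<open>\<gamma> lies strictly between m - 1 and m; hence the functional equation of
      Gamma applies at every argument below.\<close>
    have nI: "\<gamma> \<noteq> of_int i" for i
      using \<beta> by (cases "int m \<le> i") (auto simp: \<gamma>_def)
    have "z \<notin> \<int>\<^sub>\<le>\<^sub>0" if "z \<in> {\<gamma>, \<gamma> + 1, -\<gamma>, -(\<gamma> + 1)}" for z
    proof
      assume "z \<in> \<int>\<^sub>\<le>\<^sub>0"
      then obtain k where "z = - real k" by (elim nonpos_Ints_cases')
      with that show False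
        using nI[of "- int k"] nI[of "- int k - 1"] nI[of "int k"] nI[of "int k - 1"] by auto
    qed
    then have ns: "\<gamma> \<noteq> 0" "\<gamma> + 1 \<noteq> 0" "\<gamma> \<notin> \<int>\<^sub>\<le>\<^sub>0" "\<gamma> + 1 \<notin> \<int>\<^sub>\<le>\<^sub>0" "-\<gamma> \<notin> \<int>\<^sub>\<le>\<^sub>0" "-(\<gamma> + 1) \<notin> \<int>\<^sub>\<le>\<^sub>0"
      using \<gamma> nI[of 0] by auto
    have "(LBINT \<eta>:{0<..}. \<eta> powr (\<gamma> + 1) * exp (-\<eta>) / (\<eta> + x)) =
      (LBINT \<eta>:{0<..}. \<eta> powr \<gamma> * exp (-\<eta>) - x * (\<eta> powr \<gamma> * exp (-\<eta>) / (\<eta> + x)))"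
      using assms(3) by (intro set_lebesgue_integral_cong) (auto simp: powr_add divide_simps algebra_simps)
    also have "\<dots> = Gamma (\<gamma> + 1) - x * (LBINT \<eta>:{0<..}. \<eta> powr \<gamma> * exp (-\<eta>) / (\<eta> + x))"
      using set_integral_Gamma(1)[OF \<gamma>]
      by (subst set_integral_diff(2)[OF _ set_integrable_mult_right[OF set_integrable_div_shift]])
        (simp_all only: set_integral_mult_right set_integral_Gamma(2)[OF \<gamma>] assms(3))
    also have "\<dots> = Gamma (\<gamma> + 1) * (1 - x / \<gamma> * conf_hypergeo 1 (1 - \<gamma>) x)
        - Gamma (-\<gamma>) * Gamma (\<gamma> + 1) * (x * x powr \<gamma>) * exp x"
      using ns(1) unfolding Suc.IH[folded \<gamma>_def] Gamma_plus1[OF ns(3)] by (simp add: algebra_simps)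
    \<comment> \<open>With c = -\<gamma>, the relation for first parameter 1 absorbs the isolated 1
      into the series.\<close>
    also have "1 - x / \<gamma> * conf_hypergeo 1 (1 - \<gamma>) x = conf_hypergeo 1 (1 - (\<gamma> + 1)) x"
      using conf_hypergeo_1_left[OF ns(5), of x] by simp
    \<comment> \<open>The two Gamma shifts produce the factors -(\<gamma> + 1) and 1 / (\<gamma> +
      1); the resulting sign cancels the minus before the exponential term.\<close>
    also have "Gamma (-\<gamma>) * Gamma (\<gamma> + 1) = - (Gamma (-(\<gamma> + 1)) * Gamma (\<gamma> + 1 + 1))"
    proof -
      have *: "Gamma (-\<gamma>) = - (\<gamma> + 1) * Gamma (-(\<gamma> + 1))"
        using Gamma_plus1[OF ns(6)] by (simp add: algebra_simps)
      show ?thesis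
        by (simp only: * Gamma_plus1[OF ns(4)] mult_minus_left mult_minus_right mult_ac)
    qed
    also have "x * x powr \<gamma> = x powr (\<gamma> + 1)"
      using assms(3) by (simp add: powr_add)
    finally show ?case
      by (simp add: \<gamma>_def algebra_simps)
  qed
  \<comment> \<open>The ceiling serves as m: it is nonnegative because \<alpha> > -1, so
    \<open>nat\<close> truncates nothing.\<close>
  have "real (nat \<lceil>\<alpha>\<rceil>) = of_int \<lceil>\<alpha>\<rceil>"
    using assms(1) by simp
  moreover from this have "\<alpha> \<noteq> of_int \<lceil>\<alpha>\<rceil>"
    using assms(2) by (metis of_nat_in_Nats)
  ultimately show ?thesis
    using shifted[of "\<alpha> - of_int \<lceil>\<alpha>\<rceil>" "nat \<lceil>\<alpha>\<rceil>"] ceiling_correct[of \<alpha>] by simp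
qed

lemma set_integral_sum:
  fixes f :: "'i \<Rightarrow> 'a \<Rightarrow> real"
  assumes "\<And>i. i \<in> I \<Longrightarrow> set_integrable M A (f i)"
  shows set_integrable_sum: "set_integrable M A (\<lambda>x. \<Sum>i\<in>I. f i x)"
    and "(LINT x:A|M. (\<Sum>i\<in>I. f i x)) = (\<Sum>i\<in>I. LINT x:A|M. f i x)"
  using assms unfolding set_integrable_def set_lebesgue_integral_def scaleR_sum_right
  by (auto intro: Bochner_Integration.integral_sum)

section \<open>Laguerre polynomials: coefficients, three-term recurrence, orthogonality to
  constants\<close>

text \<open>The coefficient of \<open>x ^ k\<close>, in Gamma form so that the functional equation
  shifts n and k. The value 0 beyond k = n lets polynomials of different degrees be summed over a
  common range.\<close>

definition laguerre_coeff :: "real \<Rightarrow> nat \<Rightarrow> nat \<Rightarrow> real" where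
  "laguerre_coeff \<alpha> n k =
    (if k \<le> n then (-1) ^ k * Gamma (real n + \<alpha> + 1) / (fact k * fact (n - k) * Gamma (real k + \<alpha> + 1)) else 0)"

lemma laguerre_conv_coeff:
  assumes "\<alpha> > -1" "n \<le> N"
  shows "laguerre n \<alpha> x = (\<Sum>k\<le>N. laguerre_coeff \<alpha> n k * x ^ k)"
proof -
  have "laguerre n \<alpha> x = (\<Sum>k\<le>n. laguerre_coeff \<alpha> n k * x ^ k)"
    unfolding laguerre_def atLeast0AtMost
  proof (intro sum.cong refl)
    fix k assume "k \<in> {..n}"
    then have "k \<le> n" "real n + \<alpha> - real (n - k) + 1 = real k + \<alpha> + 1" by auto
    with laguerre_coeff_Gamma[OF assms(1) \<open>k \<le> n\<close>]
    show "(real n + \<alpha> gchoose (n - k)) * ((- 1) ^ k * x ^ k / fact k) = laguerre_coeff \<alpha> n k * x ^ k"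
      by (simp add: laguerre_coeff_def ac_simps)
  qed
  also have "\<dots> = (\<Sum>k\<le>N. laguerre_coeff \<alpha> n k * x ^ k)"
    using assms(2) by (intro sum.mono_neutral_left) (auto simp: laguerre_coeff_def)
  finally show ?thesis .
qed

lemma laguerre_0 [simp]: "laguerre 0 \<alpha> x = 1"
  by (simp add: laguerre_def)

text \<open>The functional equation of Gamma in n. Free of division, it includes k = n + 1, where
  the left factor and the right coefficient vanish.\<close>

lemma laguerre_coeff_Suc_left:
  assumes "\<alpha> > -1"
  shows "(real n + 1 - real k) * laguerre_coeff \<alpha> (Suc n) k = (real n + 1 + \<alpha>) * laguerre_coeff \<alpha> n k"
proof (cases "k \<le> n")
  case True
  have "Gamma (real n + \<alpha> + 1 + 1) = (real n + \<alpha> + 1) * Gamma (real n + \<alpha> + 1)"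
    using assms by (intro Gamma_plus1) (auto elim!: nonpos_Ints_cases')
  then show ?thesis
    using True by (simp add: laguerre_coeff_def Suc_diff_le of_nat_diff divide_simps) (simp add: algebra_simps)
next
  case False
  then show ?thesis by (cases "k = Suc n") (auto simp: laguerre_coeff_def)
qed

lemma laguerre_coeff_Suc_right:
  assumes "\<alpha> > -1"
  shows "(real k + 1) * (real k + \<alpha> + 1) * laguerre_coeff \<alpha> n (Suc k) = - (real n - real k) * laguerre_coeff \<alpha> n k"
proof (cases "Suc k \<le> n")
  case True
  have "Gamma (real k + \<alpha> + 1 + 1) = (real k + \<alpha> + 1) * Gamma (real k + \<alpha> + 1)"
    using assms by (intro Gamma_plus1) (auto elim!: nonpos_Ints_cases')
  moreover have "Gamma (real k + \<alpha> + 1) > 0" "real k + \<alpha> + 1 > 0" using assms by auto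
  moreover have "fact (n - k) = (real n - real k) * fact (n - Suc k)"
    using True fact_reduce[of "n - k", where 'a = real] by (simp add: of_nat_diff)
  ultimately show ?thesis
    using True by (simp add: laguerre_coeff_def divide_simps) (simp add: algebra_simps)
next
  case False
  then show ?thesis by (cases "k = n") (auto simp: laguerre_coeff_def)
qed

text \<open>After multiplication by n + 2 - k, the two shift relations make every term a multiple of
  B, the coefficient at (n + 1, k). For k = n + 2 this factor is zero, and the leading coefficients
  are compared directly.\<close>

lemma laguerre_coeff_three_term:
  assumes "\<alpha> > -1"
  shows "(real n + 2) * laguerre_coeff \<alpha> (Suc (Suc n)) k =
    (2 * real n + 3 + \<alpha>) * laguerre_coeff \<alpha> (Suc n) k
    - (if k = 0 then 0 else laguerre_coeff \<alpha> (Suc n) (k - 1)) - (real n + 1 + \<alpha>) * laguerre_coeff \<alpha> n k"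
proof -
  let ?c = "laguerre_coeff \<alpha>"
  define B where "B = ?c (Suc n) k"
  have A: "(real n + 1 + \<alpha>) * ?c n k = (real n + 1 - real k) * B"
    using laguerre_coeff_Suc_left[OF assms, of n k] by (simp add: B_def)
  have D: "(if k = 0 then 0 else (real n + 2 - real k) * ?c (Suc n) (k - 1)) = - (real k * (real k + \<alpha>) * B)"
    using laguerre_coeff_Suc_right[OF assms, of "k - 1" "Suc n"]
    by (cases k) (simp_all add: B_def algebra_simps)
  have C: "(real n + 2 - real k) * ?c (Suc (Suc n)) k = (real n + 2 + \<alpha>) * B"
    using laguerre_coeff_Suc_left[OF assms, of "Suc n" k] by (simp add: B_def add_ac)
  show ?thesis
  proof (cases "k = n + 2")
    case True
    have "Gamma (real n + \<alpha> + 2) > 0" "Gamma (real n + \<alpha> + 3) > 0" using assms by auto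
    then show ?thesis
      using True by (simp add: laguerre_coeff_def add_ac divide_simps)
  next
    case False
    then have nz: "real n + 2 - real k \<noteq> 0" by auto
    have "(real n + 2 - real k) * ((real n + 2) * ?c (Suc (Suc n)) k) = (real n + 2) * ((real n + 2 + \<alpha>) * B)"
      using C by (simp add: mult.left_commute)
    \<comment> \<open>The identity (n+2)(n+2+\<alpha>) = (n+2-k)(n+2+\<alpha>+k) +
      k(k+\<alpha>).\<close>
    also have "\<dots> = (real n + 2 - real k) * ((2 * real n + 3 + \<alpha>) * B - (real n + 1 - real k) * B)
        + real k * (real k + \<alpha>) * B"
      by (simp add: algebra_simps)
    also have "\<dots> = (real n + 2 - real k) * ((2 * real n + 3 + \<alpha>) * B
        - (if k = 0 then 0 else ?c (Suc n) (k - 1)) - (real n + 1 + \<alpha>) * ?c n k)"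
      using D A by (simp add: right_diff_distrib split: if_splits)
    finally show ?thesis
      using nz by (simp add: B_def)
  qed
qed

lemma laguerre_three_term:
  assumes "\<alpha> > -1"
  shows "(real n + 2) * laguerre (Suc (Suc n)) \<alpha> x =
    (2 * real n + 3 + \<alpha> - x) * laguerre (Suc n) \<alpha> x - (real n + 1 + \<alpha>) * laguerre n \<alpha> x"
proof -
  let ?N = "Suc (Suc n)"
  let ?c = "laguerre_coeff \<alpha>"
  have "x * laguerre (Suc n) \<alpha> x = (\<Sum>k\<le>Suc n. ?c (Suc n) k * x ^ Suc k)"
    by (simp add: laguerre_conv_coeff[OF assms order_refl] sum_distrib_left ac_simps del: sum.atMost_Suc)
  \<comment> \<open>Multiplication by x raises each index by one; k = 0 is separate because
    \<open>0 - 1 = 0\<close> on the naturals.\<close>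
  also have "\<dots> = (\<Sum>k\<le>?N. (if k = 0 then 0 else ?c (Suc n) (k - 1)) * x ^ k)"
    by (subst (2) sum.atMost_Suc_shift) simp
  finally have x: "x * laguerre (Suc n) \<alpha> x = \<dots>" .
  have "(real n + 2) * laguerre ?N \<alpha> x = (\<Sum>k\<le>?N. ((real n + 2) * ?c ?N k) * x ^ k)"
    by (simp add: laguerre_conv_coeff[OF assms order_refl] sum_distrib_left mult.assoc del: sum.atMost_Suc)
  also have "\<dots> = (2 * real n + 3 + \<alpha>) * (\<Sum>k\<le>?N. ?c (Suc n) k * x ^ k)
      - (\<Sum>k\<le>?N. (if k = 0 then 0 else ?c (Suc n) (k - 1)) * x ^ k)
      - (real n + 1 + \<alpha>) * (\<Sum>k\<le>?N. ?c n k * x ^ k)"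
    unfolding laguerre_coeff_three_term[OF assms] sum_distrib_left left_diff_distrib sum_subtractf
    by (simp only: mult.assoc)
  also have "\<dots> = (2 * real n + 3 + \<alpha>) * laguerre (Suc n) \<alpha> x - x * laguerre (Suc n) \<alpha> x
      - (real n + 1 + \<alpha>) * laguerre n \<alpha> x"
    unfolding x using laguerre_conv_coeff[OF assms, of n ?N] laguerre_conv_coeff[OF assms, of "Suc n" ?N] by simp
  finally show ?thesis by (simp add: algebra_simps)
qed

lemma laguerre_weight_expand:
  assumes "\<alpha> > -1" "\<eta> > 0"
  shows "\<eta> powr \<alpha> * exp (-\<eta>) * laguerre n \<alpha> \<eta>
    = (\<Sum>k\<le>n. laguerre_coeff \<alpha> n k * (\<eta> powr (\<alpha> + real k) * exp (-\<eta>)))"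
  using assms
  by (simp add: laguerre_conv_coeff[OF assms(1) order_refl] sum_distrib_left powr_add powr_realpow ac_simps)

lemma set_integrable_laguerre_weight:
  assumes "\<alpha> > -1"
  shows "set_integrable lborel {0<..} (\<lambda>\<eta>. \<eta> powr \<alpha> * exp (-\<eta>) * laguerre n \<alpha> \<eta>)"
proof -
  have "set_integrable lborel {0<..} (\<lambda>\<eta>. \<Sum>k\<le>n. laguerre_coeff \<alpha> n k * (\<eta> powr (\<alpha> + real k) * exp (-\<eta>)))"
    using assms by (intro set_integrable_sum set_integrable_mult_right set_integral_Gamma) auto
  then show ?thesis
    using laguerre_weight_expand[OF assms] by (subst set_integrable_cong[OF refl refl]) auto
qed

text \<open>The moment \<open>Gamma (\<alpha> + k + 1)\<close> cancels the Gamma value in the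
  denominator of the k-th coefficient. What remains is a constant times the alternating sum of the
  binomial coefficients of n, which is zero for n > 0.\<close>

lemma set_integral_laguerre_weight:
  assumes "\<alpha> > -1" "n > 0"
  shows "(LBINT \<eta>:{0<..}. \<eta> powr \<alpha> * exp (-\<eta>) * laguerre n \<alpha> \<eta>) = 0"
proof -
  have "(LBINT \<eta>:{0<..}. \<eta> powr \<alpha> * exp (-\<eta>) * laguerre n \<alpha> \<eta>)
      = (LBINT \<eta>:{0<..}. (\<Sum>k\<le>n. laguerre_coeff \<alpha> n k * (\<eta> powr (\<alpha> + real k) * exp (-\<eta>))))"
    using laguerre_weight_expand[OF assms(1)] by (intro set_lebesgue_integral_cong) auto
  also have "\<dots> = (\<Sum>k\<le>n. LBINT \<eta>:{0<..}. laguerre_coeff \<alpha> n k * (\<eta> powr (\<alpha> + real k) * exp (-\<eta>)))"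
    using assms by (intro set_integral_sum(2) set_integrable_mult_right set_integral_Gamma) auto
  also have "\<dots> = (\<Sum>k\<le>n. laguerre_coeff \<alpha> n k * Gamma (\<alpha> + real k + 1))"
    using assms by (simp add: set_integral_Gamma)
  also have "\<dots> = (\<Sum>k\<le>n. Gamma (real n + \<alpha> + 1) / fact n * ((-1) ^ k * of_nat (n choose k)))"
  proof (intro sum.cong refl)
    fix k assume k: "k \<in> {..n}"
    have "Gamma (\<alpha> + real k + 1) > 0" using assms by auto
    then show "laguerre_coeff \<alpha> n k * Gamma (\<alpha> + real k + 1) = Gamma (real n + \<alpha> + 1) / fact n * ((-1) ^ k * of_nat (n choose k))"
      using k by (simp add: laguerre_coeff_def binomial_fact add.commute add.left_commute)
  qed
  also have "\<dots> = 0"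
    using choose_alternating_sum[OF assms(2), where 'a = real] unfolding sum_distrib_left[symmetric] by simp
  finally show ?thesis .
qed

section \<open>Matching the recurrences in n on both sides\<close>

theorem theorem4p3:
  fixes \<alpha> \<xi> :: real and n :: nat
  assumes "\<alpha> > -1" and "\<alpha> \<notin> \<nat>" and "\<xi> < 0"
  shows "set_integrable lborel {0<..}
           (\<lambda>\<eta>. \<eta> powr \<alpha> * exp (-\<eta>) * laguerre n \<alpha> \<eta> / (\<eta> - \<xi>))
       \<and> (LBINT \<eta>:{0<..}. \<eta> powr \<alpha> * exp (-\<eta>) * laguerre n \<alpha> \<eta> / (\<eta> - \<xi>))
         = Gamma \<alpha> * conf_hypergeo (real n + 1) (1 - \<alpha>) (-\<xi>)
           + Gamma (-\<alpha>) * Gamma (real n + \<alpha> + 1) / fact n * (-\<xi>) powr \<alpha>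
             * conf_hypergeo (real n + 1 + \<alpha>) (1 + \<alpha>) (-\<xi>)"
proof -
  define x where "x = - \<xi>"
  have x: "x > 0" and \<xi>: "\<eta> - \<xi> = \<eta> + x" for \<eta>
    using assms by (auto simp: x_def)
  let ?w = "\<lambda>n \<eta>. \<eta> powr \<alpha> * exp (-\<eta>) * laguerre n \<alpha> \<eta>"
  define I where "I n = (LBINT \<eta>:{0<..}. ?w n \<eta> / (\<eta> + x))" for n
  \<comment> \<open>The claim involves \<open>M (Suc n)\<close> and \<open>M' (Suc n)\<close>; with
    this offset the recurrence of M starts from \<open>M 0\<close>, a series reduced to the constant
    1.\<close>
  define M where "M n = conf_hypergeo (real n) (1 - \<alpha>) x" for n
  define M' where "M' n = conf_hypergeo (real n + \<alpha>) (1 + \<alpha>) x" for n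
  define G where "G n = Gamma (real n + \<alpha> + 1) / fact n" for n
  note w = set_integrable_laguerre_weight[OF assms(1)]
  note wx = set_integrable_div_shift[OF w x]
  have \<alpha>0: "\<alpha> \<noteq> 0"
    using assms(2) by auto
  have nI: "1 - \<alpha> \<notin> \<int>\<^sub>\<le>\<^sub>0" "1 + \<alpha> \<notin> \<int>\<^sub>\<le>\<^sub>0" "\<alpha> \<notin> \<int>\<^sub>\<le>\<^sub>0"
  proof -
    show "1 + \<alpha> \<notin> \<int>\<^sub>\<le>\<^sub>0" "\<alpha> \<notin> \<int>\<^sub>\<le>\<^sub>0"
      using assms(1) \<alpha>0 by (auto elim!: nonpos_Ints_cases')
    show "1 - \<alpha> \<notin> \<int>\<^sub>\<le>\<^sub>0"
    proof
      assume "1 - \<alpha> \<in> \<int>\<^sub>\<le>\<^sub>0"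
      then obtain k where "\<alpha> = real (Suc k)"
        by (elim nonpos_Ints_cases') (auto simp: algebra_simps)
      then show False using assms(2) by (metis of_nat_in_Nats)
    qed
  qed
  \<comment> \<open>Write 2n+3+\<alpha>-\<eta> as (2n+3+\<alpha>+x) - (\<eta>+x). The second bracket
    cancels the denominator and leaves the weighted integral of a Laguerre polynomial of positive
    degree, which is 0.\<close>
  have I_rec: "(real n + 2) * I (Suc (Suc n)) = (2 * real n + 3 + \<alpha> + x) * I (Suc n) - (real n + 1 + \<alpha>) * I n" for n
  proof -
    have "(real n + 2) * I (Suc (Suc n)) = (LBINT \<eta>:{0<..}. (real n + 2) * (?w (Suc (Suc n)) \<eta> / (\<eta> + x)))"
      unfolding I_def by (rule set_integral_mult_right[symmetric])
    also have "\<dots> = (LBINT \<eta>:{0<..}. (2 * real n + 3 + \<alpha> + x) * (?w (Suc n) \<eta> / (\<eta> + x))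
        - (real n + 1 + \<alpha>) * (?w n \<eta> / (\<eta> + x)) - ?w (Suc n) \<eta>)"
    proof (intro set_lebesgue_integral_cong allI impI)
      fix \<eta> :: real assume "\<eta> \<in> {0<..}"
      then have [simp]: "\<eta> + x \<noteq> 0" using x by auto
      let ?L = "\<lambda>n. laguerre n \<alpha> \<eta>" and ?v = "\<eta> powr \<alpha> * exp (-\<eta>) / (\<eta> + x)"
      have "(real n + 2) * (?w (Suc (Suc n)) \<eta> / (\<eta> + x)) = ?v * ((real n + 2) * ?L (Suc (Suc n)))"
        by simp
      also have "\<dots> = ?v * ((2 * real n + 3 + \<alpha> + x) * ?L (Suc n) - (real n + 1 + \<alpha>) * ?L n - (\<eta> + x) * ?L (Suc n))"
        unfolding laguerre_three_term[OF assms(1)] by (simp add: algebra_simps)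
      also have "\<dots> = (2 * real n + 3 + \<alpha> + x) * (?v * ?L (Suc n)) - (real n + 1 + \<alpha>) * (?v * ?L n)
          - (?v * (\<eta> + x)) * ?L (Suc n)"
        by (simp only: right_diff_distrib mult_ac)
      finally show "(real n + 2) * (?w (Suc (Suc n)) \<eta> / (\<eta> + x)) =
          (2 * real n + 3 + \<alpha> + x) * (?w (Suc n) \<eta> / (\<eta> + x)) - (real n + 1 + \<alpha>) * (?w n \<eta> / (\<eta> + x)) - ?w (Suc n) \<eta>"
        by simp
    qed auto
    also have "\<dots> = (2 * real n + 3 + \<alpha> + x) * I (Suc n) - (real n + 1 + \<alpha>) * I n"
    proof -
      note int = wx[THEN set_integrable_mult_right]
      show ?thesis
        by (simp only: set_integral_diff(2)[OF set_integral_diff(1)[OF int int] w] set_integral_diff(2)[OF int int]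
            set_integral_mult_right set_integral_laguerre_weight[OF assms(1) zero_less_Suc] I_def diff_0_right)
    qed
    finally show ?thesis .
  qed
  \<comment> \<open>The contiguous relation at a = n+1, c = 1-\<alpha>; for \<open>M'\<close> it is
    used at a = n+1+\<alpha>, c = 1+\<alpha>.\<close>
  have M_rec: "(real n + 1) * M (Suc (Suc n)) = (2 * real n + 1 + \<alpha> + x) * M (Suc n) - (real n + \<alpha>) * M n" for n
    using conf_hypergeo_contiguous[OF nI(1), of "real n + 1" x] by (simp add: M_def algebra_simps)
  have M'_rec: "(real n + 1 + \<alpha>) * M' (Suc (Suc n)) = (2 * real n + 1 + \<alpha> + x) * M' (Suc n) - real n * M' n" for n
    using conf_hypergeo_contiguous[OF nI(2), of "real n + 1 + \<alpha>" x] by (simp add: M'_def algebra_simps)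
  have M0: "M 0 = 1"
    by (simp add: M_def conf_hypergeo_0_left)
  have M'1: "M' (Suc 0) = exp x"
    using conf_hypergeo_self[OF nI(2)] by (simp add: M'_def)
  have G_Suc: "(real n + 1) * G (Suc n) = (real n + 1 + \<alpha>) * G n" for n
  proof -
    have "Gamma (real n + \<alpha> + 1 + 1) = (real n + \<alpha> + 1) * Gamma (real n + \<alpha> + 1)"
      using assms(1) by (intro Gamma_plus1) (auto elim!: nonpos_Ints_cases')
    then show ?thesis by (simp add: G_def divide_simps) (simp add: algebra_simps)
  qed
  have Gamma\<alpha>: "Gamma (\<alpha> + 1) = \<alpha> * Gamma \<alpha>"
    by (rule Gamma_plus1[OF nI(3)])
  define R where "R n = Gamma \<alpha> * M (Suc n) + Gamma (-\<alpha>) * x powr \<alpha> * (G n * M' (Suc n))" for n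
  \<comment> \<open>The factor G replaces the leading coefficient n+1+\<alpha> by n+1, as in the
    recurrence of M.\<close>
  have GM_rec: "(real n + 1) * (G (Suc n) * M' (Suc (Suc n))) = G n * ((2 * real n + 1 + \<alpha> + x) * M' (Suc n) - real n * M' n)" for n
  proof -
    have "(real n + 1) * (G (Suc n) * M' (Suc (Suc n))) = G n * ((real n + 1 + \<alpha>) * M' (Suc (Suc n)))"
      by (simp only: mult.assoc[symmetric] G_Suc) simp
    then show ?thesis by (simp only: M'_rec)
  qed
  have R0: "I 0 = R 0"
    using set_integral_Stieltjes[OF assms(1,2) x] M'1 by (simp add: I_def R_def M_def G_def)
  \<comment> \<open>The general recurrence does not reach this second initial value, since the bare
    weight integrates to \<open>Gamma (\<alpha> + 1)\<close> instead of 0. On the other side the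
    same number comes from \<open>Gamma \<alpha> * \<alpha> * M 0\<close>, while \<open>M' 0\<close>
    has coefficient 0.\<close>
  have R1: "I (Suc 0) = R (Suc 0)"
  proof -
    have "I (Suc 0) = (LBINT \<eta>:{0<..}. (1 + \<alpha> + x) * (?w 0 \<eta> / (\<eta> + x)) - ?w 0 \<eta>)"
      unfolding I_def using x
      by (intro set_lebesgue_integral_cong) (auto simp: laguerre_def divide_simps algebra_simps)
    also have "\<dots> = (1 + \<alpha> + x) * I 0 - Gamma (\<alpha> + 1)"
      by (simp only: set_integral_diff(2)[OF set_integrable_mult_right[OF wx] w] set_integral_mult_right I_def)
        (simp add: set_integral_Gamma[OF assms(1)])
    also have "\<dots> = R (Suc 0)"
    proof -
      have "R (Suc 0) = Gamma \<alpha> * ((1 + \<alpha> + x) * M (Suc 0) - \<alpha>)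
          + Gamma (-\<alpha>) * x powr \<alpha> * (G 0 * ((1 + \<alpha> + x) * M' (Suc 0)))"
        using M_rec[of 0] GM_rec[of 0] M0 by (simp add: R_def)
      then show ?thesis
        unfolding R0 Gamma\<alpha> by (simp add: R_def algebra_simps)
    qed
    finally show ?thesis .
  qed
  have R_rec: "(real n + 2) * R (Suc (Suc n)) = (2 * real n + 3 + \<alpha> + x) * R (Suc n) - (real n + 1 + \<alpha>) * R n" for n
  proof -
    have "(real n + 2) * R (Suc (Suc n)) = Gamma \<alpha> * ((real (Suc n) + 1) * M (Suc (Suc (Suc n))))
        + Gamma (-\<alpha>) * x powr \<alpha> * ((real (Suc n) + 1) * (G (Suc (Suc n)) * M' (Suc (Suc (Suc n)))))"
      by (simp add: R_def algebra_simps)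
    also have "\<dots> = Gamma \<alpha> * ((2 * real n + 3 + \<alpha> + x) * M (Suc (Suc n)) - (real n + 1 + \<alpha>) * M (Suc n))
        + Gamma (-\<alpha>) * x powr \<alpha> * ((2 * real n + 3 + \<alpha> + x) * (G (Suc n) * M' (Suc (Suc n)))
          - ((real n + 1) * G (Suc n)) * M' (Suc n))"
      unfolding M_rec GM_rec by (simp add: algebra_simps)
    \<comment> \<open>\<open>G_Suc\<close> turns (n+1) G(n+1) into (n+1+\<alpha>) G(n), so both
      parts of R share the last coefficient.\<close>
    also have "\<dots> = (2 * real n + 3 + \<alpha> + x) * R (Suc n) - (real n + 1 + \<alpha>) * R n"
      unfolding G_Suc R_def by (simp add: algebra_simps)
    finally show ?thesis .
  qed
  \<comment> \<open>The recurrence has order two, so two consecutive values are carried; its leading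
    factor n + 2 is nonzero and cancels.\<close>
  have "I n = R n \<and> I (Suc n) = R (Suc n)" for n
  proof (induction n)
    case 0
    show ?case using R0 R1 by simp
  next
    case (Suc n)
    then have "(real n + 2) * I (Suc (Suc n)) = (real n + 2) * R (Suc (Suc n))"
      by (simp only: I_rec R_rec)
    then show ?case using Suc by simp
  qed
  then have "I n = R n" ..
  moreover have "set_integrable lborel {0<..} (\<lambda>\<eta>. ?w n \<eta> / (\<eta> + x))"
    by (rule wx)
  ultimately show ?thesis
    unfolding \<xi> by (simp add: I_def R_def M_def M'_def G_def x_def[symmetric] add_ac mult_ac)
qed

end
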